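(* Let $X_i\subset\mathbb{R}^{n_{x_i}}$, $Y_i\subset\mathbb{R}^{n_{y_i}}$ ($i=1,2$) be solids, $X=X_1\times X_2$, $Y=Y_1\times Y_2$, $Z=X\times Y$, $Z_1=X_1\times Y_1$, and let $\Psi=\Psi(x_1,x_2,y_1,y_2):Z\to\mathbb{R}$ be a continuous function, convex in $x=(x_1,x_2)\in X$ and concave in $y=(y_1,y_2)\in Y$, satisfying Assumption C (see context). Let $\mathbf{B}$ be a solid containing $Z_1$, and let $P_\tau=\{(z_1^t,e^t)\}_{t=1}^\tau$, $z_1^t=(x_1^t,y_1^t)$, be a $\tau$-point execution protocol generated with the $\Phi$-oracle and a separation oracle for $Z_1$ (see context), augmented by the pairs $z_2^t=(x_2^t,y_2^t)$, $t\in I_\tau$, reported by the $\Phi$-oracle at the steps $t\in I_\tau$. Suppose that $P_\tau$ admits an accuracy certificate $\zeta=(\zeta_t)_{t=1}^\tau$, and set $$\widehat{x}_i^\tau=\sum_{t\in I_\tau}\zeta_t x_i^t,\qquad \widehat{y}_i^\tau=\sum_{t\in I_\tau}\zeta_t y_i^t,\qquad i=1,2,$$ $\widehat{x}^\tau=(\widehat{x}_1^\tau,\widehat{x}_2^\tau)$, $\widehat{y}^\tau=(\widehat{y}_1^\tau,\widehat{y}_2^\tau)$. Then $(\widehat{x}^\tau,\widehat{y}^\tau)\in Z$ and $$\varepsilon_{\rm sad}\big((\widehat{x}^\tau,\widehat{y}^\tau)\,\big|\,\Psi,X,Y\big)\le \varepsilon_{\rm cert}(\zeta|P_\tau,\mathbf{B}),$$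 whence also $$\varepsilon_{\rm sad}\big((\widehat{x}_i^\tau,\widehat{y}_i^\tau)\,\big|\,\Psi_i,X_i,Y_i\big)\le \varepsilon_{\rm cert}(\zeta|P_\tau,\mathbf{B}),\qquad i=1,2.$$
   Context: A solid is a convex compact set with nonempty interior in the indicated Euclidean space; $\mathrm{int}$ denotes interior. Induced functions: $\Psi_1(x_1,y_1)=\min_{x_2\in X_2}\max_{y_2\in Y_2}\Psi(x_1,x_2,y_1,y_2)$ on $X_1\times Y_1$, and $\Psi_2(x_2,y_2)=\min_{x_1\in X_1}\max_{y_1\in Y_1}\Psi(x_1,x_2,y_1,y_2)$ on $X_2\times Y_2$. Saddle point inaccuracy: for convex compact sets $U,V$, a continuous convex-concave function $F:U\times V\to\mathbb{R}$ and $(u,v)\in U\times V$, $\varepsilon_{\rm sad}((u,v)|F,U,V)=\max_{v'\in V}F(u,v')-\min_{u'\in U}F(u',v)$. Assumption C. (i) $\Psi$ is differentiable in $x_2\in X_2$ whenever $x_1\in\mathrm{int}\,X_1$, $y_1\in\mathrm{int}\,Y_1$, $y_2\in Y_2$, and for every $y\in\mathrm{int}\,Y_1\times Y_2$ this derivative is continuous in $x\in\mathrm{int}\,X_1\times X_2$. (ii) $\Psi$ is differentiable in $y_2\in Y_2$ whenever $x_1\in\mathrm{int}\,X_1$, $y_1\in\mathrm{int}\,Y_1$, $x_2\in X_2$, and for every $x\in\mathrm{int}\,X_1\times X_2$ this derivative is continuous in $y\in\mathrm{int}\,Y_1\times Y_2$. (At boundary points of $X_2$, $Y_2$ differentiability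 is understood relative to $X_2$, resp. $Y_2$.) Regular sub/supergradients: let $(x,y)=((x_1,x_2),(y_1,y_2))\in Z$ with $(x_1,y_1)\in\mathrm{int}\,X_1\times\mathrm{int}\,Y_1$. A regular subgradient $\Psi'_x(x,y)$ is a subgradient at $x$ of the convex function $\Psi(\cdot,y)$ on $X$ whose projection onto $\mathbb{R}^{n_{x_2}}$ equals the gradient at $x_2$ of the function $\Psi(x_1,\cdot,y)$. A regular supergradient $\Psi'_y(x,y)$ is a supergradient at $y$ of the concave function $\Psi(x,\cdot)$ on $Y$ whose projection onto $\mathbb{R}^{n_{y_2}}$ equals the gradient at $y_2$ of the function $\Psi(x,y_1,\cdot)$. Under Assumption C these exist at such points. $\Phi$-oracle: given $(x_1,y_1)\in\mathrm{int}\,X_1\times\mathrm{int}\,Y_1$, it computes a saddle point $(x_2,y_2)$ of the problem $\min_{\xi_2\in X_2}\max_{\eta_2\in Y_2}\Psi(x_1,\xi_2,y_1,\eta_2)$; it computes $e_{x_1}$, the projection onto $\mathbb{R}^{n_{x_1}}$ of a regular subgradient $\Psi'_x$ at $(x_1,x_2,y_1,y_2)$, and $e_{y_1}$, where $-e_{y_1}$ is the projection onto $\mathbb{R}^{n_{y_1}}$ of a regular supergradient $\Psi'_y$ at $(x_1,x_2,y_1,y_2)$; and it returns $(x_2,y_2)$ and $\Phi(x_1,y_1)=(e_{x_1},e_{y_1})$. Execution protocol: a finite sequence $P_\tau=\{(z_1^t,e^t)\}_{t=1}^\tau$ of search points $z_1^t=(x_1^t,y_1^t)\in\mathbb{R}^{n_{x_1}}\times\mathbb{R}^{n_{y_1}}$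 and vectors $e^t\in\mathbb{R}^{n_{x_1}}\times\mathbb{R}^{n_{y_1}}$. The index set $\{1,\dots,\tau\}$ is partitioned into $I_\tau=\{t: z_1^t\in\mathrm{int}\,Z_1\}$ and $J_\tau=\{t:z_1^t\notin\mathrm{int}\,Z_1\}$. For $t\in I_\tau$, $e^t=\Phi(z_1^t)$ is the vector returned by the $\Phi$-oracle, and $(x_2^t,y_2^t)$ is the pair it returned; for $t\in J_\tau$, $e^t$ is a nonzero separator of $z_1^t$ and $Z_1$, i.e. $e^t\neq0$ and $\langle e^t,z_1^t-z\rangle\ge0$ for all $z\in Z_1$. Accuracy certificate for $P_\tau$: a collection of nonnegative weights $\zeta=(\zeta_t)_{t=1}^\tau$ with $\sum_{t\in I_\tau}\zeta_t=1$. Its resolution is $\varepsilon_{\rm cert}(\zeta|P_\tau,\mathbf{B})=\max_{z\in\mathbf{B}}\sum_{t=1}^\tau\zeta_t\langle e^t,z_1^t-z\rangle$. *)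

theory Defs
  imports "HOL-Analysis.Analysis"
begin

text \<open>
  Points of the full domain are nested pairs \<open>((x1, x2), (y1, y2))\<close>, and the Euclidean
  spaces are arbitrary types of class \<open>euclidean_space\<close>; the library's inner product, norm and
  topology on products are those of the orthogonal direct sum.

  Extrema over compact sets are written with \<open>SUP\<close> and \<open>INF\<close>. Under the hypotheses of the
  theorem every one of them is attained, so they are the maxima and minima of the mathematics.
\<close>

definition solid :: "'a::euclidean_space set \<Rightarrow> bool" where
  "solid S \<longleftrightarrow> convex S \<and> compact S \<and> interior S \<noteq> {}"

definition sad_inaccuracy :: "('u \<times> 'v \<Rightarrow> real) \<Rightarrow> 'u set \<Rightarrow> 'v set \<Rightarrow> 'u \<times> 'v \<Rightarrow> real" where
  "sad_inaccuracy F U V = (\<lambda>(u, v). (SUP v'\<in>V. F (u, v')) - (INF u'\<in>U. F (u', v)))"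

definition induced1 ::
  "(('a \<times> 'b) \<times> ('c \<times> 'd) \<Rightarrow> real) \<Rightarrow> 'b set \<Rightarrow> 'd set \<Rightarrow> 'a \<times> 'c \<Rightarrow> real" where
  "induced1 \<Psi> X2 Y2 = (\<lambda>(x1, y1). INF x2\<in>X2. SUP y2\<in>Y2. \<Psi> ((x1, x2), (y1, y2)))"

definition induced2 ::
  "(('a \<times> 'b) \<times> ('c \<times> 'd) \<Rightarrow> real) \<Rightarrow> 'a set \<Rightarrow> 'c set \<Rightarrow> 'b \<times> 'd \<Rightarrow> real" where
  "induced2 \<Psi> X1 Y1 = (\<lambda>(x2, y2). INF x1\<in>X1. SUP y1\<in>Y1. \<Psi> ((x1, x2), (y1, y2)))"

text \<open>
  The gradient relative to a set, generalising \<open>gderiv\<close>. It is only used for convex sets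
  with nonempty interior, where it is unique (also at boundary points).
\<close>

definition has_gradient_within ::
  "('a::euclidean_space \<Rightarrow> real) \<Rightarrow> 'a \<Rightarrow> 'a \<Rightarrow> 'a set \<Rightarrow> bool" where
  "has_gradient_within f g x S \<longleftrightarrow> (f has_derivative (\<lambda>h. h \<bullet> g)) (at x within S)"

text \<open>In the next definition \<open>G\<close> is the partial gradient as a function of the relevant pair.\<close>

definition assumption_C ::
  "(('a::euclidean_space \<times> 'b::euclidean_space) \<times> ('c::euclidean_space \<times> 'd::euclidean_space) \<Rightarrow> real)
    \<Rightarrow> 'a set \<Rightarrow> 'b set \<Rightarrow> 'c set \<Rightarrow> 'd set \<Rightarrow> bool" where
  "assumption_C \<Psi> X1 X2 Y1 Y2 \<longleftrightarrow>
     (\<forall>y1\<in>interior Y1. \<forall>y2\<in>Y2. \<exists>G.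
        (\<forall>x1\<in>interior X1. \<forall>x2\<in>X2.
           has_gradient_within (\<lambda>\<xi>. \<Psi> ((x1, \<xi>), (y1, y2))) (G (x1, x2)) x2 X2) \<and>
        continuous_on (interior X1 \<times> X2) G) \<and>
     (\<forall>x1\<in>interior X1. \<forall>x2\<in>X2. \<exists>G.
        (\<forall>y1\<in>interior Y1. \<forall>y2\<in>Y2.
           has_gradient_within (\<lambda>\<eta>. \<Psi> ((x1, x2), (y1, \<eta>))) (G (y1, y2)) y2 Y2) \<and>
        continuous_on (interior Y1 \<times> Y2) G)"

definition subgradient_on ::
  "'a::euclidean_space set \<Rightarrow> ('a \<Rightarrow> real) \<Rightarrow> 'a \<Rightarrow> 'a \<Rightarrow> bool" where
  "subgradient_on S f x g \<longleftrightarrow> x \<in> S \<and> (\<forall>u\<in>S. f u \<ge> f x + g \<bullet> (u - x))"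

definition supergradient_on ::
  "'a::euclidean_space set \<Rightarrow> ('a \<Rightarrow> real) \<Rightarrow> 'a \<Rightarrow> 'a \<Rightarrow> bool" where
  "supergradient_on S f x g \<longleftrightarrow> x \<in> S \<and> (\<forall>u\<in>S. f u \<le> f x + g \<bullet> (u - x))"

definition regular_subgradient ::
  "(('a::euclidean_space \<times> 'b::euclidean_space) \<times> ('c::euclidean_space \<times> 'd::euclidean_space) \<Rightarrow> real)
    \<Rightarrow> 'a set \<Rightarrow> 'b set \<Rightarrow> 'a \<times> 'b \<Rightarrow> 'c \<times> 'd \<Rightarrow> 'a \<times> 'b \<Rightarrow> bool" where
  "regular_subgradient \<Psi> X1 X2 x y g \<longleftrightarrow>
     subgradient_on (X1 \<times> X2) (\<lambda>x'. \<Psi> (x', y)) x g \<and>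
     has_gradient_within (\<lambda>\<xi>. \<Psi> ((fst x, \<xi>), y)) (snd g) (snd x) X2"

definition regular_supergradient ::
  "(('a::euclidean_space \<times> 'b::euclidean_space) \<times> ('c::euclidean_space \<times> 'd::euclidean_space) \<Rightarrow> real)
    \<Rightarrow> 'c set \<Rightarrow> 'd set \<Rightarrow> 'a \<times> 'b \<Rightarrow> 'c \<times> 'd \<Rightarrow> 'c \<times> 'd \<Rightarrow> bool" where
  "regular_supergradient \<Psi> Y1 Y2 x y g \<longleftrightarrow>
     supergradient_on (Y1 \<times> Y2) (\<lambda>y'. \<Psi> (x, y')) y g \<and>
     has_gradient_within (\<lambda>\<eta>. \<Psi> (x, (fst y, \<eta>))) (snd g) (snd y) Y2"

text \<open>Saddle points are for minimization over the first and maximization over the second argument.\<close>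

definition saddle_point :: "('u \<times> 'v \<Rightarrow> real) \<Rightarrow> 'u set \<Rightarrow> 'v set \<Rightarrow> 'u \<times> 'v \<Rightarrow> bool" where
  "saddle_point F U V = (\<lambda>(u, v). u \<in> U \<and> v \<in> V \<and>
     (\<forall>v'\<in>V. F (u, v') \<le> F (u, v)) \<and> (\<forall>u'\<in>U. F (u, v) \<le> F (u', v)))"

text \<open>
  At a query point \<open>(x1, y1)\<close> the answer consists of the saddle point \<open>sol (x1, y1)\<close> and the
  vector \<open>\<Phi> (x1, y1)\<close>. Note the sign of its second component.
\<close>

definition Phi_oracle ::
  "(('a::euclidean_space \<times> 'b::euclidean_space) \<times> ('c::euclidean_space \<times> 'd::euclidean_space) \<Rightarrow> real)
    \<Rightarrow> 'a set \<Rightarrow> 'b set \<Rightarrow> 'c set \<Rightarrow> 'd set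
    \<Rightarrow> ('a \<times> 'c \<Rightarrow> 'b \<times> 'd) \<Rightarrow> ('a \<times> 'c \<Rightarrow> 'a \<times> 'c) \<Rightarrow> bool" where
  "Phi_oracle \<Psi> X1 X2 Y1 Y2 sol \<Phi> \<longleftrightarrow>
     (\<forall>x1\<in>interior X1. \<forall>y1\<in>interior Y1. \<exists>x2 y2 gx gy.
        sol (x1, y1) = (x2, y2) \<and>
        saddle_point (\<lambda>(\<xi>2, \<eta>2). \<Psi> ((x1, \<xi>2), (y1, \<eta>2))) X2 Y2 (x2, y2) \<and>
        regular_subgradient \<Psi> X1 X2 (x1, x2) (y1, y2) gx \<and>
        regular_supergradient \<Psi> Y1 Y2 (x1, x2) (y1, y2) gy \<and>
        \<Phi> (x1, y1) = (fst gx, - fst gy))"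

definition productive_steps :: "nat \<Rightarrow> (nat \<Rightarrow> 'z::euclidean_space) \<Rightarrow> 'z set \<Rightarrow> nat set" where
  "productive_steps \<tau> z Z1 = {t \<in> {1..\<tau>}. z t \<in> interior Z1}"

definition nonproductive_steps :: "nat \<Rightarrow> (nat \<Rightarrow> 'z::euclidean_space) \<Rightarrow> 'z set \<Rightarrow> nat set" where
  "nonproductive_steps \<tau> z Z1 = {t \<in> {1..\<tau>}. z t \<notin> interior Z1}"

definition separator :: "'z::euclidean_space set \<Rightarrow> 'z \<Rightarrow> 'z \<Rightarrow> bool" where
  "separator Z1 p e \<longleftrightarrow> e \<noteq> 0 \<and> (\<forall>z\<in>Z1. e \<bullet> (p - z) \<ge> 0)"

text \<open>
  A protocol augmented by the pairs \<open>z2 t\<close> returned at productive steps. Sequences are indexed by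
  \<open>{1..\<tau>}\<close>; other values, and those of \<open>z2\<close> at nonproductive steps, are irrelevant.
\<close>

definition execution_protocol ::
  "('z::euclidean_space \<Rightarrow> 'w) \<Rightarrow> ('z \<Rightarrow> 'z) \<Rightarrow> 'z set \<Rightarrow> nat
    \<Rightarrow> (nat \<Rightarrow> 'z) \<Rightarrow> (nat \<Rightarrow> 'w) \<Rightarrow> (nat \<Rightarrow> 'z) \<Rightarrow> bool" where
  "execution_protocol sol \<Phi> Z1 \<tau> z1 z2 e \<longleftrightarrow>
     (\<forall>t\<in>productive_steps \<tau> z1 Z1. z2 t = sol (z1 t) \<and> e t = \<Phi> (z1 t)) \<and>
     (\<forall>t\<in>nonproductive_steps \<tau> z1 Z1. separator Z1 (z1 t) (e t))"

definition accuracy_certificate ::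
  "'z::euclidean_space set \<Rightarrow> nat \<Rightarrow> (nat \<Rightarrow> 'z) \<Rightarrow> (nat \<Rightarrow> real) \<Rightarrow> bool" where
  "accuracy_certificate Z1 \<tau> z1 \<zeta> \<longleftrightarrow>
     (\<forall>t\<in>{1..\<tau>}. \<zeta> t \<ge> 0) \<and> (\<Sum>t\<in>productive_steps \<tau> z1 Z1. \<zeta> t) = 1"

definition cert_resolution ::
  "nat \<Rightarrow> (nat \<Rightarrow> 'z::euclidean_space) \<Rightarrow> (nat \<Rightarrow> 'z) \<Rightarrow> 'z set \<Rightarrow> (nat \<Rightarrow> real) \<Rightarrow> real" where
  "cert_resolution \<tau> z1 e B \<zeta> = (SUP z\<in>B. \<Sum>t=1..\<tau>. \<zeta> t * (e t \<bullet> (z1 t - z)))"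

end

theory Submission
  imports Defs
begin

text \<open>
  Everything follows from one bound on the gap function
  \<open>\<Psi> (xh, v) - \<Psi> (u, yh)\<close>, uniform in \<open>u \<in> X1 \<times> X2\<close> and \<open>v \<in> Y1 \<times> Y2\<close>.

  At a productive step \<open>t\<close> the subgradient inequality bounds \<open>\<Psi> (x\<^sup>t, y\<^sup>t) - \<Psi> (u, y\<^sup>t)\<close> by
  the pairing of the subgradient with \<open>x\<^sup>t - u\<close>. Regularity identifies the second block of that
  subgradient with the gradient in \<open>x2\<close>, and \<open>x2\<^sup>t\<close> is a minimizer of the inner problem, so by
  first-order optimality this block contributes nothing positive and only the block in \<open>x1\<close>,
  the one the oracle reports, remains. The same argument in \<open>y\<close> and addition give
  \<open>\<Psi> (x\<^sup>t, v) - \<Psi> (u, y\<^sup>t) \<le> e\<^sup>t \<bullet> (z1\<^sup>t - (u1, v1))\<close> (\<open>Phi_oracle_gap\<close>).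

  Averaging with the certificate weights, Jensen's inequality replaces the points by their
  averages on the left (\<open>gap_average\<close>). On the right the separators at the nonproductive steps
  only add nonnegative terms, because \<open>(u1, v1)\<close> lies in \<open>X1 \<times> Y1\<close>; the complete sum is at most
  the resolution because \<open>(u1, v1)\<close> lies in \<open>B\<close>.

  The bound passes to the induced functions: the value of \<open>induced1\<close> at \<open>(xh1, v1)\<close> is
  bounded above by inserting \<open>xh2\<close> for the minimization variable, and its value at
  \<open>(u1, yh1)\<close> is bounded below by inserting \<open>yh2\<close> for the maximization variable
  (\<open>gap_bound_induced1\<close>).
\<close>

section \<open>First-order bounds at a search point\<close>

text \<open>
  Only feasible directions are available when the minimizer lies on the boundary, so the
  one-sided difference quotients along the segment to \<open>u\<close> take the place of the usual argument.
\<close>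

lemma gradient_at_minimum_nonneg:
  fixes f :: "'a::euclidean_space \<Rightarrow> real"
  assumes grad: "has_gradient_within f g x S"
    and S: "convex S" "x \<in> S" "u \<in> S"
    and min: "\<And>w. w \<in> S \<Longrightarrow> f x \<le> f w"
  shows "g \<bullet> (u - x) \<ge> 0"
proof -
  define p where "p = (\<lambda>s::real. x + s *\<^sub>R (u - x))"
  have p_mem: "p s \<in> S" if "s \<in> {0..1}" for s
  proof -
    have "(1 - s) *\<^sub>R x + s *\<^sub>R u \<in> S"
      using S that by (intro convexD) auto
    then show ?thesis by (simp add: p_def algebra_simps)
  qed
  have "(p has_derivative (\<lambda>s. s *\<^sub>R (u - x))) (at 0 within {0..1})"
    unfolding p_def by (auto intro!: derivative_eq_intros)
  moreover have "(f has_derivative (\<lambda>h. h \<bullet> g)) (at (p 0) within p ` {0..1})"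
    using grad p_mem unfolding has_gradient_within_def
    by (auto simp: p_def intro: has_derivative_subset)
  ultimately have "((f \<circ> p) has_derivative ((\<lambda>h. h \<bullet> g) \<circ> (\<lambda>s. s *\<^sub>R (u - x)))) (at 0 within {0..1})"
    by (rule diff_chain_within)
  moreover have "(\<lambda>h. h \<bullet> g) \<circ> (\<lambda>s. s *\<^sub>R (u - x)) = (*) (g \<bullet> (u - x))"
    by (auto simp: inner_commute)
  ultimately have "((f \<circ> p) has_field_derivative (g \<bullet> (u - x))) (at 0 within {0..1})"
    by (simp add: has_field_derivative_def)
  then have "((\<lambda>s. ((f \<circ> p) s - (f \<circ> p) 0) / (s - 0)) \<longlongrightarrow> g \<bullet> (u - x)) (at 0 within {0..1})"
    by (simp add: has_field_derivative_iff)
  moreover have "\<forall>\<^sub>F s in at 0 within {0..1}. 0 \<le> ((f \<circ> p) s - (f \<circ> p) 0) / (s - 0)"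
    unfolding eventually_at_filter
    using min[OF p_mem] by (intro always_eventually) (simp add: p_def)
  moreover have "at (0::real) within {0..1} \<noteq> bot"
    by (simp add: at_within_Icc_at_right)
  ultimately show ?thesis
    by (rule tendsto_lowerbound)
qed

text \<open>
  Minimality of the second block removes the second block of a regular subgradient from the
  subgradient inequality.
\<close>

lemma regular_subgradient_gap:
  assumes reg: "regular_subgradient \<Psi> X1 X2 (x1, x2) y g"
    and "convex X2"
    and min: "\<And>w. w \<in> X2 \<Longrightarrow> \<Psi> ((x1, x2), y) \<le> \<Psi> ((x1, w), y)"
    and u: "u1 \<in> X1" "u2 \<in> X2"
  shows "\<Psi> ((x1, x2), y) - \<Psi> ((u1, u2), y) \<le> fst g \<bullet> (x1 - u1)"
proof -
  have sub: "\<Psi> ((u1, u2), y) \<ge> \<Psi> ((x1, x2), y) + g \<bullet> ((u1, u2) - (x1, x2))"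
    and mem: "x2 \<in> X2"
    using reg u by (auto simp: regular_subgradient_def subgradient_on_def)
  have "snd g \<bullet> (u2 - x2) \<ge> 0"
    using gradient_at_minimum_nonneg[of "\<lambda>\<xi>. \<Psi> ((x1, \<xi>), y)" "snd g" x2 X2 u2]
      reg \<open>convex X2\<close> mem u min by (auto simp: regular_subgradient_def)
  with sub show ?thesis
    by (cases g) (auto simp: inner_diff_right)
qed

text \<open>Carries the results on subgradients at minimizers over to supergradients at maximizers.\<close>

lemma regular_subgradient_uminus_swap:
  assumes "regular_supergradient \<Psi> Y1 Y2 x y g"
  shows "regular_subgradient (\<lambda>(y, x). - \<Psi> (x, y)) Y1 Y2 y x (- g)"
  using assms
  by (force simp: regular_supergradient_def regular_subgradient_def supergradient_on_def
      subgradient_on_def has_gradient_within_def dest: has_derivative_minus)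

lemma regular_supergradient_gap:
  assumes "regular_supergradient \<Psi> Y1 Y2 x (y1, y2) g"
    and "convex Y2"
    and "\<And>w. w \<in> Y2 \<Longrightarrow> \<Psi> (x, (y1, w)) \<le> \<Psi> (x, (y1, y2))"
    and "v1 \<in> Y1" "v2 \<in> Y2"
  shows "\<Psi> (x, (v1, v2)) - \<Psi> (x, (y1, y2)) \<le> - fst g \<bullet> (y1 - v1)"
  using regular_subgradient_gap[OF regular_subgradient_uminus_swap[OF assms(1)]] assms(2-)
  by auto

lemma Phi_oracle_gap:
  assumes "Phi_oracle \<Psi> X1 X2 Y1 Y2 sol \<Phi>"
    and "convex X2" "convex Y2"
    and "x1 \<in> interior X1" "y1 \<in> interior Y1"
    and "sol (x1, y1) = (x2, y2)"
    and "u1 \<in> X1" "u2 \<in> X2" "v1 \<in> Y1" "v2 \<in> Y2"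
  shows "\<Psi> ((x1, x2), (v1, v2)) - \<Psi> ((u1, u2), (y1, y2))
    \<le> \<Phi> (x1, y1) \<bullet> ((x1, y1) - (u1, v1))"
proof -
  obtain gx gy where
    sp: "saddle_point (\<lambda>(\<xi>2, \<eta>2). \<Psi> ((x1, \<xi>2), (y1, \<eta>2))) X2 Y2 (x2, y2)"
    and gx: "regular_subgradient \<Psi> X1 X2 (x1, x2) (y1, y2) gx"
    and gy: "regular_supergradient \<Psi> Y1 Y2 (x1, x2) (y1, y2) gy"
    and \<Phi>: "\<Phi> (x1, y1) = (fst gx, - fst gy)"
    using assms unfolding Phi_oracle_def by fastforce
  have "\<Psi> ((x1, x2), (y1, y2)) - \<Psi> ((u1, u2), (y1, y2)) \<le> fst gx \<bullet> (x1 - u1)"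
    using regular_subgradient_gap[OF gx] sp assms by (simp add: saddle_point_def)
  moreover have "\<Psi> ((x1, x2), (v1, v2)) - \<Psi> ((x1, x2), (y1, y2)) \<le> - fst gy \<bullet> (y1 - v1)"
    using regular_supergradient_gap[OF gy] sp assms by (simp add: saddle_point_def)
  ultimately show ?thesis by (simp add: \<Phi>)
qed

section \<open>Averaging over the protocol\<close>

text \<open>Jensen's inequality, applied to the convex and to the concave argument separately.\<close>

lemma gap_average:
  fixes F :: "'u::real_vector \<times> 'v::real_vector \<Rightarrow> real"
  assumes "convex_on U (\<lambda>x. F (x, v))" "concave_on V (\<lambda>y. F (u, y))"
    and "finite I" "I \<noteq> {}" "\<And>t. t \<in> I \<Longrightarrow> \<zeta> t \<ge> 0" "sum \<zeta> I = 1"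
    and "\<And>t. t \<in> I \<Longrightarrow> x t \<in> U" "\<And>t. t \<in> I \<Longrightarrow> y t \<in> V"
  shows "F (\<Sum>t\<in>I. \<zeta> t *\<^sub>R x t, v) - F (u, \<Sum>t\<in>I. \<zeta> t *\<^sub>R y t)
    \<le> (\<Sum>t\<in>I. \<zeta> t * (F (x t, v) - F (u, y t)))"
proof -
  have "F (\<Sum>t\<in>I. \<zeta> t *\<^sub>R x t, v) \<le> (\<Sum>t\<in>I. \<zeta> t * F (x t, v))"
    using convex_on_sum[OF assms(3,4,1,6,5,7)] by simp
  moreover have "- F (u, \<Sum>t\<in>I. \<zeta> t *\<^sub>R y t) \<le> (\<Sum>t\<in>I. \<zeta> t * - F (u, y t))"
    using convex_on_sum[OF assms(3,4) assms(2)[unfolded concave_on_def] assms(6,5,8)] by simp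
  ultimately show ?thesis
    by (simp add: right_diff_distrib sum_subtractf sum_negf)
qed

text \<open>Compactness of \<open>B\<close> makes the supremum in the definition of the resolution finite.\<close>

lemma cert_resolution_upper:
  assumes "compact B" "z \<in> B"
  shows "(\<Sum>t=1..\<tau>. \<zeta> t * (e t \<bullet> (z1 t - z))) \<le> cert_resolution \<tau> z1 e B \<zeta>"
  unfolding cert_resolution_def
proof (rule cSUP_upper[OF \<open>z \<in> B\<close>])
  have "compact ((\<lambda>z. \<Sum>t=1..\<tau>. \<zeta> t * (e t \<bullet> (z1 t - z))) ` B)"
    using \<open>compact B\<close> by (intro compact_continuous_image continuous_intros)
  then show "bdd_above ((\<lambda>z. \<Sum>t=1..\<tau>. \<zeta> t * (e t \<bullet> (z1 t - z))) ` B)"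
    by (intro bounded_imp_bdd_above compact_imp_bounded)
qed

text \<open>The separators at the remaining steps contribute nonnegative terms to the complete sum.\<close>

lemma productive_sum_le_cert_resolution:
  assumes "compact B" "Z1 \<subseteq> B" "z \<in> Z1"
    and "execution_protocol sol \<Phi> Z1 \<tau> z1 z2 e"
    and "accuracy_certificate Z1 \<tau> z1 \<zeta>"
  shows "(\<Sum>t\<in>productive_steps \<tau> z1 Z1. \<zeta> t * (e t \<bullet> (z1 t - z)))
    \<le> cert_resolution \<tau> z1 e B \<zeta>"
proof -
  have "0 \<le> \<zeta> t * (e t \<bullet> (z1 t - z))" if "t \<in> {1..\<tau>} - productive_steps \<tau> z1 Z1" for t
    using that assms(3-5)
    by (intro mult_nonneg_nonneg)
      (auto simp: accuracy_certificate_def execution_protocol_def separator_def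
        productive_steps_def nonproductive_steps_def)
  then have "(\<Sum>t\<in>productive_steps \<tau> z1 Z1. \<zeta> t * (e t \<bullet> (z1 t - z)))
      \<le> (\<Sum>t=1..\<tau>. \<zeta> t * (e t \<bullet> (z1 t - z)))"
    by (intro sum_mono2) (auto simp: productive_steps_def)
  also have "\<dots> \<le> cert_resolution \<tau> z1 e B \<zeta>"
    using assms by (intro cert_resolution_upper) auto
  finally show ?thesis .
qed

section \<open>From pointwise gaps to saddle point inaccuracies\<close>

lemma sad_inaccuracy_le:
  assumes "U \<noteq> {}" "V \<noteq> {}"
    and gap: "\<And>u' v'. u' \<in> U \<Longrightarrow> v' \<in> V \<Longrightarrow> F (u, v') - F (u', v) \<le> c"
  shows "sad_inaccuracy F U V (u, v) \<le> c"
proof -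
  have "(SUP v'\<in>V. F (u, v')) - c \<le> F (u', v)" if "u' \<in> U" for u'
  proof -
    have "(SUP v'\<in>V. F (u, v')) \<le> c + F (u', v)"
      using gap[OF that] by (intro cSUP_least assms) (force simp: algebra_simps)
    then show ?thesis by simp
  qed
  then have "(SUP v'\<in>V. F (u, v')) - c \<le> (INF u'\<in>U. F (u', v))"
    by (intro cINF_greatest assms)
  then show ?thesis by (simp add: sad_inaccuracy_def)
qed

text \<open>
  Boundedness of \<open>\<Psi>\<close> ensures that the infima and suprema are genuine, so that inserting a point
  for the variable of an infimum (supremum) gives an upper (lower) bound.
\<close>

lemma gap_bound_induced1:
  assumes bdd: "bounded (\<Psi> ` ((X1 \<times> X2) \<times> (Y1 \<times> Y2)))"
    and mem: "xh1 \<in> X1" "xh2 \<in> X2" "yh1 \<in> Y1" "yh2 \<in> Y2"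
    and gap: "\<And>u1 u2 v1 v2. u1 \<in> X1 \<Longrightarrow> u2 \<in> X2 \<Longrightarrow> v1 \<in> Y1 \<Longrightarrow> v2 \<in> Y2 \<Longrightarrow>
      \<Psi> ((xh1, xh2), (v1, v2)) - \<Psi> ((u1, u2), (yh1, yh2)) \<le> c"
  shows "sad_inaccuracy (induced1 \<Psi> X2 Y2) X1 Y1 (xh1, yh1) \<le> c"
proof (rule sad_inaccuracy_le)
  fix u1 v1 assume u1: "u1 \<in> X1" and v1: "v1 \<in> Y1"
  obtain M where M: "\<And>a b c d. a \<in> X1 \<Longrightarrow> b \<in> X2 \<Longrightarrow> c \<in> Y1 \<Longrightarrow> d \<in> Y2 \<Longrightarrow>
      \<bar>\<Psi> ((a, b), (c, d))\<bar> \<le> M"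
    using bdd by (fastforce simp: bounded_iff)
  have bdd_sup: "bdd_above ((\<lambda>d. \<Psi> ((a, b), (c, d))) ` Y2)"
    if "a \<in> X1" "b \<in> X2" "c \<in> Y1" for a b c
    using M[OF that] by (intro bdd_aboveI2[where M = M]) force
  have le_sup: "\<Psi> ((a, b), (c, yh2)) \<le> (SUP d\<in>Y2. \<Psi> ((a, b), (c, d)))"
    if "a \<in> X1" "b \<in> X2" "c \<in> Y1" for a b c
    using bdd_sup[OF that] mem by (intro cSUP_upper)
  have "bdd_below ((\<lambda>b. SUP d\<in>Y2. \<Psi> ((xh1, b), (v1, d))) ` X2)"
  proof (rule bdd_belowI2)
    fix b assume b: "b \<in> X2"
    show "- M \<le> (SUP d\<in>Y2. \<Psi> ((xh1, b), (v1, d)))"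
      using le_sup[OF mem(1) b v1] M[OF mem(1) b v1 mem(4)] by linarith
  qed
  then have upper: "induced1 \<Psi> X2 Y2 (xh1, v1) \<le> (SUP d\<in>Y2. \<Psi> ((xh1, xh2), (v1, d)))"
    unfolding induced1_def using mem by (auto intro: cINF_lower)
  have "(SUP d\<in>Y2. \<Psi> ((xh1, xh2), (v1, d))) - c \<le> induced1 \<Psi> X2 Y2 (u1, yh1)"
    unfolding induced1_def prod.case
  proof (rule cINF_greatest)
    fix u2 assume u2: "u2 \<in> X2"
    have "(SUP d\<in>Y2. \<Psi> ((xh1, xh2), (v1, d))) \<le> \<Psi> ((u1, u2), (yh1, yh2)) + c"
      using gap[OF u1 u2 v1] mem by (intro cSUP_least) (force simp: algebra_simps)+
    then show "(SUP d\<in>Y2. \<Psi> ((xh1, xh2), (v1, d))) - c \<le> (SUP d\<in>Y2. \<Psi> ((u1, u2), (yh1, d)))"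
      using le_sup[OF u1 u2 mem(3)] by linarith
  qed (use mem in auto)
  with upper show "induced1 \<Psi> X2 Y2 (xh1, v1) - induced1 \<Psi> X2 Y2 (u1, yh1) \<le> c"
    by linarith
qed (use mem in auto)

text \<open>The roles of the two blocks are symmetric, so exchanging them reduces this to the previous case.\<close>

lemma gap_bound_induced2:
  assumes bdd: "bounded (\<Psi> ` ((X1 \<times> X2) \<times> (Y1 \<times> Y2)))"
    and mem: "xh1 \<in> X1" "xh2 \<in> X2" "yh1 \<in> Y1" "yh2 \<in> Y2"
    and gap: "\<And>u1 u2 v1 v2. u1 \<in> X1 \<Longrightarrow> u2 \<in> X2 \<Longrightarrow> v1 \<in> Y1 \<Longrightarrow> v2 \<in> Y2 \<Longrightarrow>
      \<Psi> ((xh1, xh2), (v1, v2)) - \<Psi> ((u1, u2), (yh1, yh2)) \<le> c"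
  shows "sad_inaccuracy (induced2 \<Psi> X1 Y1) X2 Y2 (xh2, yh2) \<le> c"
proof -
  define \<Psi>' where "\<Psi>' = (\<lambda>((b, a), (d, c)). \<Psi> ((a, b), (c, d)))"
  have "\<Psi>' ` ((X2 \<times> X1) \<times> (Y2 \<times> Y1)) \<subseteq> \<Psi> ` ((X1 \<times> X2) \<times> (Y1 \<times> Y2))"
    by (auto simp: \<Psi>'_def)
  with bdd have "bounded (\<Psi>' ` ((X2 \<times> X1) \<times> (Y2 \<times> Y1)))"
    by (rule bounded_subset)
  then have "sad_inaccuracy (induced1 \<Psi>' X1 Y1) X2 Y2 (xh2, yh2) \<le> c"
    by (rule gap_bound_induced1) (use mem gap in \<open>auto simp: \<Psi>'_def\<close>)
  moreover have "induced1 \<Psi>' X1 Y1 = induced2 \<Psi> X1 Y1"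
    by (simp add: induced1_def induced2_def \<Psi>'_def)
  ultimately show ?thesis by simp
qed

section \<open>The accuracy bound\<close>

theorem theorem1:
  fixes X1 :: "'a::euclidean_space set" and X2 :: "'b::euclidean_space set"
    and Y1 :: "'c::euclidean_space set" and Y2 :: "'d::euclidean_space set"
    and \<Psi> :: "('a \<times> 'b) \<times> ('c \<times> 'd) \<Rightarrow> real"
    and sol :: "'a \<times> 'c \<Rightarrow> 'b \<times> 'd" and \<Phi> :: "'a \<times> 'c \<Rightarrow> 'a \<times> 'c"
    and B :: "('a \<times> 'c) set"
    and \<tau> :: nat
    and x1 :: "nat \<Rightarrow> 'a" and x2 :: "nat \<Rightarrow> 'b" and y1 :: "nat \<Rightarrow> 'c" and y2 :: "nat \<Rightarrow> 'd"
    and e :: "nat \<Rightarrow> 'a \<times> 'c"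
    and \<zeta> :: "nat \<Rightarrow> real"
    and I :: "nat set"
    and xh1 :: 'a and xh2 :: 'b and yh1 :: 'c and yh2 :: 'd
  assumes "solid X1" and "solid X2" and "solid Y1" and "solid Y2"
    and "continuous_on ((X1 \<times> X2) \<times> (Y1 \<times> Y2)) \<Psi>"
    and "\<And>y. y \<in> Y1 \<times> Y2 \<Longrightarrow> convex_on (X1 \<times> X2) (\<lambda>x. \<Psi> (x, y))"
    and "\<And>x. x \<in> X1 \<times> X2 \<Longrightarrow> concave_on (Y1 \<times> Y2) (\<lambda>y. \<Psi> (x, y))"
    and "assumption_C \<Psi> X1 X2 Y1 Y2"
    and "solid B" and "X1 \<times> Y1 \<subseteq> B"
    and "Phi_oracle \<Psi> X1 X2 Y1 Y2 sol \<Phi>"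
    and "execution_protocol sol \<Phi> (X1 \<times> Y1) \<tau> (\<lambda>t. (x1 t, y1 t)) (\<lambda>t. (x2 t, y2 t)) e"
    and "accuracy_certificate (X1 \<times> Y1) \<tau> (\<lambda>t. (x1 t, y1 t)) \<zeta>"
    and "I = productive_steps \<tau> (\<lambda>t. (x1 t, y1 t)) (X1 \<times> Y1)"
    and "xh1 = (\<Sum>t\<in>I. \<zeta> t *\<^sub>R x1 t)" and "xh2 = (\<Sum>t\<in>I. \<zeta> t *\<^sub>R x2 t)"
    and "yh1 = (\<Sum>t\<in>I. \<zeta> t *\<^sub>R y1 t)" and "yh2 = (\<Sum>t\<in>I. \<zeta> t *\<^sub>R y2 t)"
  shows "((xh1, xh2), (yh1, yh2)) \<in> (X1 \<times> X2) \<times> (Y1 \<times> Y2)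
    \<and> sad_inaccuracy \<Psi> (X1 \<times> X2) (Y1 \<times> Y2) ((xh1, xh2), (yh1, yh2))
        \<le> cert_resolution \<tau> (\<lambda>t. (x1 t, y1 t)) e B \<zeta>
    \<and> sad_inaccuracy (induced1 \<Psi> X2 Y2) X1 Y1 (xh1, yh1)
        \<le> cert_resolution \<tau> (\<lambda>t. (x1 t, y1 t)) e B \<zeta>
    \<and> sad_inaccuracy (induced2 \<Psi> X1 Y1) X2 Y2 (xh2, yh2)
        \<le> cert_resolution \<tau> (\<lambda>t. (x1 t, y1 t)) e B \<zeta>"
proof -
  let ?R = "cert_resolution \<tau> (\<lambda>t. (x1 t, y1 t)) e B \<zeta>"
  have convex: "convex X1" "convex X2" "convex Y1" "convex Y2"
    and compact: "compact X1" "compact X2" "compact Y1" "compact Y2" "compact B"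
    using assms(1-4,9) by (auto simp: solid_def)
  have sum_1: "sum \<zeta> I = 1"
    using assms(13,14) by (simp add: accuracy_certificate_def)
  then have "I \<noteq> {}" by auto
  with sum_1 have I: "finite I" "I \<noteq> {}" "sum \<zeta> I = 1" "\<And>t. t \<in> I \<Longrightarrow> \<zeta> t \<ge> 0"
    using assms(13,14) by (simp_all add: accuracy_certificate_def productive_steps_def)
  have int: "x1 t \<in> interior X1" "y1 t \<in> interior Y1" if "t \<in> I" for t
    using that assms(14) by (auto simp: productive_steps_def interior_Times)
  have step: "sol (x1 t, y1 t) = (x2 t, y2 t)" "e t = \<Phi> (x1 t, y1 t)" if "t \<in> I" for t
    using that assms(12,14) by (auto simp: execution_protocol_def)
  have mem: "x1 t \<in> X1" "x2 t \<in> X2" "y1 t \<in> Y1" "y2 t \<in> Y2" if "t \<in> I" for t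
    using int[OF that] step(1)[OF that] assms(11) interior_subset
    by (fastforce simp: Phi_oracle_def saddle_point_def)+
  have hat_mem: "xh1 \<in> X1" "xh2 \<in> X2" "yh1 \<in> Y1" "yh2 \<in> Y2"
    unfolding assms(15-18) using I mem convex by (auto intro!: convex_sum)
  have hat_pair: "(xh1, xh2) = (\<Sum>t\<in>I. \<zeta> t *\<^sub>R (x1 t, x2 t))"
    "(yh1, yh2) = (\<Sum>t\<in>I. \<zeta> t *\<^sub>R (y1 t, y2 t))"
    unfolding assms(15-18) by (simp_all add: sum_prod)
  have gap: "\<Psi> ((xh1, xh2), (v1, v2)) - \<Psi> ((u1, u2), (yh1, yh2)) \<le> ?R"
    if uv: "u1 \<in> X1" "u2 \<in> X2" "v1 \<in> Y1" "v2 \<in> Y2" for u1 u2 v1 v2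
  proof -
    have "\<Psi> ((xh1, xh2), (v1, v2)) - \<Psi> ((u1, u2), (yh1, yh2))
        \<le> (\<Sum>t\<in>I. \<zeta> t * (\<Psi> ((x1 t, x2 t), (v1, v2)) - \<Psi> ((u1, u2), (y1 t, y2 t))))"
      unfolding hat_pair
      using uv I mem
      by (intro gap_average[where U = "X1 \<times> X2" and V = "Y1 \<times> Y2"] assms(6,7)) auto
    also have "\<dots> \<le> (\<Sum>t\<in>I. \<zeta> t * (e t \<bullet> ((x1 t, y1 t) - (u1, v1))))"
      using Phi_oracle_gap[OF assms(11) convex(2,4) int step(1) uv] I(4) step(2)
      by (intro sum_mono mult_left_mono) auto
    also have "\<dots> \<le> ?R"
      using uv unfolding assms(14)
      by (intro productive_sum_le_cert_resolution[OF compact(5) assms(10) _ assms(12,13)]) auto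
    finally show ?thesis .
  qed
  have bdd: "bounded (\<Psi> ` ((X1 \<times> X2) \<times> (Y1 \<times> Y2)))"
    using compact assms(5)
    by (intro compact_imp_bounded compact_continuous_image compact_Times) auto
  have "sad_inaccuracy \<Psi> (X1 \<times> X2) (Y1 \<times> Y2) ((xh1, xh2), (yh1, yh2)) \<le> ?R"
    using hat_mem gap by (intro sad_inaccuracy_le) auto
  with hat_mem gap_bound_induced1[OF bdd hat_mem gap] gap_bound_induced2[OF bdd hat_mem gap]
  show ?thesis by blast
qed

end
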